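(* Let $n = d(d+3)/2$ and let $\mathcal{F}_1, \ldots, \mathcal{F}_n$ be finite families of bounded sets in $\mathbb{R}^d$. Suppose that for every choice $F_1 \in \mathcal{F}_1, \ldots, F_n \in \mathcal{F}_n$, the union $\bigcup_{i=1}^n F_i$ is contained in an ellipsoid of volume one. Then there exists an index $i$ such that $\bigcup \mathcal{F}_i$ (the union of all sets in $\mathcal{F}_i$) is contained in an ellipsoid of volume one.
   Context: An ellipsoid in $\mathbb{R}^d$ is the image of the Euclidean unit ball under an invertible affine map. *)

theory Defs
  imports "HOL-Analysis.Analysis"
begin

definition ellipsoid :: "(real ^ 'd::finite) set \<Rightarrow> bool" where
  "ellipsoid E \<longleftrightarrow>
     (\<exists>(f :: real ^ 'd \<Rightarrow> real ^ 'd) b. linear f \<and> bij f \<and> E = (\<lambda>x. f x + b) ` cball 0 1)"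

end

theory Submission
  imports Defs
begin

text \<open>
  A set lies in an ellipsoid of volume one iff some upper triangular matrix \<open>A\<close> with nonnegative
  diagonal and \<open>det A \<ge> vol B\<close>, \<open>B\<close> the unit ball, and some vector \<open>b\<close> satisfy
  \<open>norm (A *v x - b) \<le> 1\<close> on the set. The pairs \<open>(A, b)\<close> range over a space of dimension
  \<open>n = d (d + 3) / 2\<close>; by AM-GM the determinant condition defines a closed convex set \<open>D\<close>, which
  misses the origin, while the norm condition of a set \<open>S\<close> defines a closed convex set \<open>K S\<close>
  containing the origin.

  Among the choices of \<open>n - 1\<close> colours and one set \<open>S\<close> of each, take one for which the point
  \<open>p\<close> of least norm in \<open>D\<close> and all \<open>K S\<close> is farthest from the origin. Let \<open>T\<close> have the missing colour
  and let \<open>p'\<close> be the point of least norm once \<open>K T\<close> is added. The set \<open>D\<close>, the open ball of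
  radius \<open>norm p'\<close> and the \<open>n\<close> sets \<open>K S\<close> have no common point, so by Helly some \<open>n + 1\<close> of them have
  none. The omitted one is not \<open>D\<close>, because of the origin, nor the ball, because of \<open>p'\<close>; so it
  is some \<open>K S\<close>, and maximality gives \<open>norm p' \<le> norm p\<close>. Hence \<open>p' = p\<close>, and \<open>p \<in> K T\<close>.
\<close>

section \<open>A colourful Helly theorem relative to a convex set\<close>

text \<open>Radon's argument run inside \<open>V\<close>, so \<open>dim V\<close> replaces the
  dimension of the ambient space. Indexing the sets lets equal sets count separately.\<close>

lemma Helly_subspace_indexed:
  fixes C :: "'i \<Rightarrow> 'a::euclidean_space set"
  assumes I: "finite I" "card I \<ge> dim V + 2"
    and conv: "\<And>i. i \<in> I \<Longrightarrow> convex (C i)"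
    and V: "subspace V"
    and meet: "\<And>i. i \<in> I \<Longrightarrow> V \<inter> (\<Inter>j\<in>I - {i}. C j) \<noteq> {}"
  shows "(\<Inter>i\<in>I. C i) \<noteq> {}"
proof -
  define x where "x i = (SOME y. y \<in> V \<inter> (\<Inter>j\<in>I - {i}. C j))" for i
  have "x i \<in> V \<inter> (\<Inter>j\<in>I - {i}. C j)" if "i \<in> I" for i
    unfolding x_def by (rule some_in_eq[THEN iffD2, OF meet[OF that]])
  then have x: "\<And>i. i \<in> I \<Longrightarrow> x i \<in> V" "\<And>i j. i \<in> I \<Longrightarrow> j \<in> I \<Longrightarrow> j \<noteq> i \<Longrightarrow> x i \<in> C j"
    by auto
  show ?thesis
  proof (cases "inj_on x I")
    \<comment> \<open>A point chosen for two different indices lies in every set, since each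
      \<open>k\<close> differs from \<open>i\<close> or from \<open>j\<close>.\<close>
    case False
    then obtain i j where ij: "i \<in> I" "j \<in> I" "i \<noteq> j" "x i = x j"
      by (auto simp: inj_on_def)
    have "x i \<in> C k" if "k \<in> I" for k
      using x(2)[of i k] x(2)[of j k] ij that by metis
    then show ?thesis by blast
  next
    case True
    have "affine_dependent (x ` I)"
    proof (rule ccontr)
      assume "\<not> affine_dependent (x ` I)"
      then have "int (card (x ` I)) \<le> aff_dim V + 1"
        using x(1) by (intro independent_card_le_aff_dim) auto
      then show False
        using I(2) by (simp add: card_image[OF True] aff_dim_subspace[OF V])
    qed
    then obtain M P z where MP: "M \<subseteq> x ` I" "P \<subseteq> x ` I" "M \<inter> P = {}"
      and z: "z \<in> convex hull M" "z \<in> convex hull P"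
      using Radon by (metis disjoint_iff)
    have "z \<in> C i" if "i \<in> I" for i
    proof -
      \<comment> \<open>The only chosen point that may miss \<open>C i\<close> is
        \<open>x i\<close>, and at least one of the disjoint parts \<open>M\<close>,
        \<open>P\<close> avoids it.\<close>
      have "N \<subseteq> C i" if "x i \<notin> N" "N \<subseteq> x ` I" for N
        using that x(2)[OF _ \<open>i \<in> I\<close>] by auto
      then have "convex hull M \<subseteq> C i \<or> convex hull P \<subseteq> C i"
        using MP hull_minimal[of _ "C i" convex] conv[OF that] by (metis disjoint_iff)
      then show ?thesis using z by blast
    qed
    then show ?thesis by blast
  qed
qed

text \<open>Together with \<open>D\<close> and a ball, the \<open>card I\<close> sets of a choice
  reach the \<open>dim V + 2\<close> sets that Helly requires. So \<open>dim V\<close> colours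
  suffice, one fewer than in the usual colourful Helly theorem.\<close>

theorem colourful_Helly_relative:
  fixes D :: "'a::euclidean_space set" and K :: "'s \<Rightarrow> 'a set" and X :: "'i \<Rightarrow> 's set"
  assumes I: "finite I" "I \<noteq> {}" "dim V \<le> card I"
    and V: "subspace V" "D \<subseteq> V"
    and D: "closed D" "convex D" "0 \<notin> D"
    and X: "\<And>i. i \<in> I \<Longrightarrow> finite (X i)" "\<And>i. i \<in> I \<Longrightarrow> X i \<noteq> {}"
    and K: "\<And>s. closed (K s)" "\<And>s. convex (K s)" "\<And>s. 0 \<in> K s"
    and sel: "\<And>g. (\<And>i. i \<in> I \<Longrightarrow> g i \<in> X i) \<Longrightarrow> D \<inter> (\<Inter>i\<in>I. K (g i)) \<noteq> {}"
  shows "\<exists>i\<in>I. D \<inter> (\<Inter>s\<in>X i. K s) \<noteq> {}"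
proof -
  define S where "S J g = D \<inter> (\<Inter>i\<in>J. K (g i))" for J :: "'i set" and g
  define q where "q J g = closest_point (S J g) 0" for J g
  have S_closed: "closed (S J g)" and S_convex: "convex (S J g)" for J g
    unfolding S_def using D K by (auto intro!: closed_Int closed_INT convex_Int convex_INT)
  have S_ne: "S J g \<noteq> {}" if "g \<in> Pi I X" "J \<subseteq> I" for J g
    using sel[of g] that unfolding S_def by (fastforce simp: Pi_iff)
  have q_in: "q J g \<in> S J g" if "g \<in> Pi I X" "J \<subseteq> I" for J g
    unfolding q_def using S_closed S_ne[OF that] by (rule closest_point_in_set)
  have q_le: "norm (q J g) \<le> norm x" if "x \<in> S J g" for x J g
    using closest_point_le[OF S_closed that, of 0] by (simp add: q_def)
  \<comment> \<open>\<open>T\<close> pairs an omitted colour \<open>j\<close> with a choice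
    \<open>g\<close> on all of \<open>I\<close>; \<open>v\<close> ignores the value of
    \<open>g\<close> at \<open>j\<close>. Extensionality of \<open>g\<close> keeps \<open>T\<close>
    finite.\<close>
  define T where "T = I \<times> PiE I X"
  define v where "v = (\<lambda>(j, g). norm (q (I - {j}) g))"
  have "finite T" "T \<noteq> {}"
    using I X by (auto simp: T_def PiE_eq_empty_iff intro!: finite_PiE)
  then obtain t where t: "t \<in> T" "\<And>t'. t' \<in> T \<Longrightarrow> v t' \<le> v t"
    using Max_in[of "v ` T"] Max_ge[of "v ` T"] by (metis (no_types, lifting) finite_imageI image_iff image_is_empty)
  obtain j g where jg: "t = (j, g)" by fastforce
  have j: "j \<in> I" and g: "g \<in> PiE I X" using t(1) by (auto simp: jg T_def)
  define p where "p = q (I - {j}) g"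
  have "p \<in> K s" if s: "s \<in> X j" for s
  proof -
    define h where "h = g(j := s)"
    have h: "h \<in> PiE I X"
      using g s j unfolding h_def by (auto simp: PiE_iff extensional_def)
    then have hPi: "h \<in> Pi I X" by (auto simp: PiE_iff)
    define p' where "p' = q I h"
    have p'_in: "p' \<in> S I h" unfolding p'_def using hPi by (rule q_in) simp
    have p'_nz: "p' \<noteq> 0" using p'_in D by (auto simp: S_def)
    have "\<exists>k\<in>I. S (I - {k}) h \<inter> ball 0 (norm p') = {}"
    proof (rule ccontr)
      assume "\<not> ?thesis"
      then have ne: "S (I - {k}) h \<inter> ball 0 (norm p') \<noteq> {}" if "k \<in> I" for k
        using that by blast
      \<comment> \<open>\<open>Inl True\<close> indexes \<open>D\<close>, \<open>Inl False\<close>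
        the ball, and \<open>Inr i\<close> the set of colour \<open>i\<close>.\<close>
      define C where "C = case_sum (\<lambda>b. if b then D else ball 0 (norm p')) (\<lambda>i. K (h i))"
      define J where "J = (UNIV :: bool set) <+> I"
      have "(\<Inter>k\<in>J. C k) \<noteq> {}"
      proof (rule Helly_subspace_indexed)
        show "finite J" "dim V + 2 \<le> card J"
          using I by (auto simp: J_def card_Plus)
        show "convex (C k)" for k
          using D K by (auto simp: C_def split: sum.split)
        show "subspace V" by fact
        show "V \<inter> (\<Inter>k'\<in>J - {k}. C k') \<noteq> {}" if "k \<in> J" for k
        proof (cases k)
          case (Inr i)
          then have "i \<in> I" using that by (auto simp: J_def)
          from ne[OF this] obtain y where "y \<in> S (I - {i}) h" "y \<in> ball 0 (norm p')" by blast
          then have "y \<in> V \<inter> (\<Inter>k'\<in>J - {k}. C k')"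
            using V Inr by (auto simp: S_def J_def C_def split: if_splits)
          then show ?thesis by blast
        next
          case (Inl b)
          show ?thesis
          proof (cases b)
            case True
            then have "0 \<in> V \<inter> (\<Inter>k'\<in>J - {k}. C k')"
              using V K p'_nz Inl by (auto simp: J_def C_def subspace_0 split: if_splits)
            then show ?thesis by blast
          next
            case False
            then have "p' \<in> V \<inter> (\<Inter>k'\<in>J - {k}. C k')"
              using V p'_in Inl by (auto simp: S_def J_def C_def split: if_splits)
            then show ?thesis by blast
          qed
        qed
      qed
      then obtain y where y: "\<And>k. k \<in> J \<Longrightarrow> y \<in> C k" by blast
      have "y \<in> D" "y \<in> ball 0 (norm p')" "\<And>i. i \<in> I \<Longrightarrow> y \<in> K (h i)"
        using y[of "Inl True"] y[of "Inl False"] y[of "Inr _"] by (auto simp: J_def C_def)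
      then have "y \<in> S I h" "norm y < norm p'" by (auto simp: S_def)
      then show False using q_le[of y I h] by (simp add: p'_def)
    qed
    then obtain k where k: "k \<in> I" "S (I - {k}) h \<inter> ball 0 (norm p') = {}" by blast
    have "q (I - {k}) h \<in> S (I - {k}) h" using hPi by (rule q_in) auto
    with k have "norm p' \<le> norm (q (I - {k}) h)" by force
    \<comment> \<open>The choice \<open>h\<close> with colour \<open>k\<close> omitted also competes
      in \<open>T\<close>, so the maximality of \<open>t\<close> applies to it.\<close>
    also have "\<dots> \<le> norm p"
      using t(2)[of "(k, h)"] k h by (simp add: T_def v_def jg p_def)
    finally have le: "norm p' \<le> norm p" .
    have sub: "S I h \<subseteq> S (I - {j}) g"
        by (auto simp: S_def h_def) metis
    \<comment> \<open>Both are points of least norm in the closed convex set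
      \<open>S (I - {j}) g\<close>, and such a point is unique.\<close>
    have "p' = p"
    proof (rule any_closest_point_unique)
      show "convex (S (I - {j}) g)" "closed (S (I - {j}) g)" by fact+
      show "p' \<in> S (I - {j}) g" using p'_in sub by blast
      show "p \<in> S (I - {j}) g" unfolding p_def using g by (intro q_in) (auto simp: PiE_iff)
      show "\<forall>z\<in>S (I - {j}) g. dist 0 p \<le> dist 0 z" using q_le by (simp add: p_def)
      then show "\<forall>z\<in>S (I - {j}) g. dist 0 p' \<le> dist 0 z" using le by fastforce
    qed
    then show ?thesis using p'_in j by (auto simp: S_def h_def)
  qed
  moreover have "p \<in> D"
    using q_in[of g "I - {j}"] g by (auto simp: p_def S_def PiE_iff)
  ultimately show ?thesis using j by blast
qed

section \<open>Triangular matrices\<close>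

text \<open>The matrix units at positions \<open>i \<le> j\<close> form a basis. The factor 2 avoids
  a division.\<close>

lemma dim_upper_triangular:
  "2 * dim {A :: real^'d::{finite,wellorder}^'d::_. \<forall>i j. j < i \<longrightarrow> A $ i $ j = 0} = CARD('d) * (CARD('d) + 1)"
proof -
  define P where "P = {(i :: 'd, j). i \<le> j}"
  define b where "b = (\<lambda>(i, j). axis i (axis j 1) :: real^'d::_^'d::_)"
  have inj: "inj b"
    by (auto simp: inj_def b_def axis_eq_axis)
  have eq: "{A :: real^'d::_^'d::_. \<forall>i j. j < i \<longrightarrow> A $ i $ j = 0}
      = {A. \<forall>e\<in>Basis. e \<notin> b ` P \<longrightarrow> A \<bullet> e = 0}"
  proof -
    have "axis i (axis j 1) \<in> b ` P \<longleftrightarrow> i \<le> j" for i j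
      using inj_image_mem_iff[OF inj, of "(i, j)" P] by (simp add: b_def P_def)
    then show ?thesis
      by (auto simp: Basis_vec_def inner_axis not_le)
  qed
  have "dim {A :: real^'d::_^'d::_. \<forall>i j. j < i \<longrightarrow> A $ i $ j = 0} = card P"
    unfolding eq
    by (subst dim_substandard) (auto simp: b_def Basis_vec_def intro!: card_image inj_on_subset[OF inj, unfolded b_def])
  \<comment> \<open>\<open>P\<close> and its transpose cover all positions and overlap exactly in
    the diagonal.\<close>
  moreover have "2 * card P = CARD('d) * (CARD('d) + 1)"
  proof -
    have "card (prod.swap ` P) = card P"
      by (intro card_image) auto
    moreover have "P \<union> prod.swap ` P = UNIV"
      by (auto simp: P_def image_iff)
    moreover have "P \<inter> prod.swap ` P = (\<lambda>i. (i, i)) ` UNIV"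
      by (auto simp: P_def)
    moreover have "card ((\<lambda>i. (i, i)) ` (UNIV :: 'd set)) = CARD('d)"
      by (intro card_image) (auto simp: inj_on_def)
    ultimately show ?thesis
      using card_Un_Int[of P "prod.swap ` P"] by simp
  qed
  ultimately show ?thesis by simp
qed

text \<open>QR decomposition: the rows of \<open>Q\<close> arise from the columns of
  \<open>A\<close> by Gram-Schmidt.\<close>

lemma orthogonal_upper_triangularization:
  fixes A :: "real^'d::{finite,wellorder}^'d::_"
  assumes "invertible A"
  obtains Q where "orthogonal_matrix Q" "\<And>i j. j < i \<Longrightarrow> (Q ** A) $ i $ j = 0"
    "\<And>i. 0 \<le> (Q ** A) $ i $ i"
proof -
  define a where "a j = column j A" for j
  obtain B where B: "B ** A = mat 1" using assms by (auto simp: invertible_def)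
  have Ba: "(B *v a j) $ i = (if i = j then 1 else 0)" for i j
  proof -
    have "(B *v a j) $ i = (B ** A) $ i $ j"
      by (simp add: a_def matrix_vector_mult_def matrix_matrix_mult_def column_def)
    then show ?thesis by (simp add: B mat_def)
  qed
  have "\<exists>q. norm q = 1 \<and> q \<in> span (a ` {..i}) \<and> (\<forall>y\<in>span (a ` {..<i}). orthogonal q y) \<and> 0 \<le> q \<bullet> a i" for i
  proof -
    \<comment> \<open>\<open>B *v x\<close> lists the coordinates of \<open>x\<close> in the basis
      of columns. Those with vanishing coordinate \<open>i\<close> contain all earlier columns but
      not \<open>a i\<close>, so the spans grow strictly.\<close>
    have "subspace {x. (B *v x) $ i = 0}"
      by (auto simp: subspace_def matrix_vector_right_distrib matrix_vector_mult_scaleR)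
    then have "span (a ` {..<i}) \<subseteq> {x. (B *v x) $ i = 0}"
      by (intro span_minimal) (auto simp: Ba)
    then have "a i \<notin> span (a ` {..<i})"
      using Ba[of i i] by auto
    moreover have "a i \<in> span (a ` {..i})" by (intro span_base) auto
    moreover have "span (a ` {..<i}) \<subseteq> span (a ` {..i})" by (intro span_mono) auto
    ultimately have "span (a ` {..<i}) \<subset> span (a ` {..i})" by blast
    then obtain x where x: "x \<noteq> 0" "x \<in> span (a ` {..i})"
      "\<And>y. y \<in> span (a ` {..<i}) \<Longrightarrow> orthogonal x y"
      by (rule orthogonal_to_subspace_exists_gen) blast
    \<comment> \<open>Scales \<open>x\<close> to unit length; the sign makes the diagonal entry of
      \<open>Q ** A\<close> nonnegative.\<close>
    define c where "c = (if 0 \<le> x \<bullet> a i then 1 / norm x else - 1 / norm x)"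
    have "norm (c *\<^sub>R x) = 1" "0 \<le> (c *\<^sub>R x) \<bullet> a i"
      using x(1) by (auto simp: c_def divide_le_0_iff zero_le_divide_iff mult_nonpos_nonpos)
    moreover have "c *\<^sub>R x \<in> span (a ` {..i})" using x by (intro span_mul)
    moreover have "\<forall>y\<in>span (a ` {..<i}). orthogonal (c *\<^sub>R x) y"
      using x(3) by (auto simp: orthogonal_def)
    ultimately show ?thesis by blast
  qed
  then obtain q where q: "\<And>i. norm (q i) = 1" "\<And>i. q i \<in> span (a ` {..i})"
    "\<And>i y. y \<in> span (a ` {..<i}) \<Longrightarrow> orthogonal (q i) y" "\<And>i. 0 \<le> q i \<bullet> a i"
    by metis
  define Q :: "real^'d::_^'d::_" where "Q = (\<chi> i. q i)"
  have QA: "(Q ** A) $ i $ j = q i \<bullet> a j" for i j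
    by (simp add: Q_def a_def matrix_matrix_mult_def inner_vec_def column_def)
  have orth: "orthogonal (q i) (q j)" if "j < i" for i j
  proof (rule q(3))
    have "span (a ` {..j}) \<subseteq> span (a ` {..<i})" using that by (intro span_mono) auto
    then show "q j \<in> span (a ` {..<i})" using q(2) by blast
  qed
  have "orthogonal_matrix Q"
    unfolding orthogonal_matrix_orthonormal_rows
    using q(1) orth by (auto simp: Q_def row_def) (metis neq_iff orthogonal_commute)
  moreover have "(Q ** A) $ i $ j = 0" if "j < i" for i j
    using q(3)[of "a j" i] that by (auto simp: QA orthogonal_def intro: span_base)
  ultimately show thesis using that q(4) by (metis QA)
qed

text \<open>Weighted AM-GM in each diagonal entry: the product of a convex combination is at least
  the weighted geometric mean of the two products.\<close>

lemma convex_prod_diagonal_ge: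
  assumes "0 < (c::real)"
  shows "convex {A :: real^'d^'d. (\<forall>i. 0 \<le> A $ i $ i) \<and> c \<le> (\<Prod>i\<in>UNIV. A $ i $ i)}" (is "convex ?C")
proof (rule convexI)
  fix A B and u v :: real
  assume A: "A \<in> ?C" and B: "B \<in> ?C" and uv: "0 \<le> u" "0 \<le> v" "u + v = 1"
  \<comment> \<open>Young's inequality needs strict positivity; no diagonal entry vanishes because
    the product is at least \<open>c > 0\<close>.\<close>
  have pos: "0 < M $ i $ i" if "M \<in> ?C" for M i
  proof -
    have "0 < (\<Prod>i\<in>UNIV. M $ i $ i)" using that assms by simp
    then have "M $ i $ i \<noteq> 0" by (metis finite UNIV_I less_irrefl prod_zero_iff)
    then show ?thesis using that by (simp add: order_less_le)
  qed
  have "c = c powr u * c powr v"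
    using assms uv by (simp flip: powr_add)
  also have "\<dots> \<le> (\<Prod>i\<in>UNIV. A $ i $ i) powr u * (\<Prod>i\<in>UNIV. B $ i $ i) powr v"
    using A B assms uv by (intro mult_mono powr_mono2) auto
  also have "\<dots> = (\<Prod>i\<in>UNIV. (A $ i $ i) powr u * (B $ i $ i) powr v)"
    using A B by (simp add: prod_powr_distrib prod.distrib)
  also have "\<dots> \<le> (\<Prod>i\<in>UNIV. u * A $ i $ i + v * B $ i $ i)"
    using pos[OF A] pos[OF B] uv by (intro prod_mono conjI Youngs_inequality_0) auto
  finally have "c \<le> (\<Prod>i\<in>UNIV. (u *\<^sub>R A + v *\<^sub>R B) $ i $ i)" by simp
  moreover have "0 \<le> (u *\<^sub>R A + v *\<^sub>R B) $ i $ i" for i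
    using A B uv by simp
  ultimately show "u *\<^sub>R A + v *\<^sub>R B \<in> ?C" by simp
qed

section \<open>Ellipsoids as points of a convex set\<close>

text \<open>
  A pair \<open>(A, b)\<close> stands for the ellipsoid of all \<open>x\<close> with \<open>norm (A *v x - b) \<le> 1\<close>; for
  admissible pairs its volume is at most one.
\<close>

definition admissible :: "((real^'d::{finite,wellorder}^'d::_) \<times> (real^'d::_)) set" where
  "admissible = {(A, b). (\<forall>i j. j < i \<longrightarrow> A $ i $ j = 0) \<and> (\<forall>i. 0 \<le> A $ i $ i) \<and>
     measure lebesgue (cball 0 1 :: (real^'d::_) set) \<le> (\<Prod>i\<in>UNIV. A $ i $ i)}"

definition enclosing :: "(real^'d) set \<Rightarrow> ((real^'d^'d) \<times> (real^'d)) set" where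
  "enclosing S = {(A, b). \<forall>x\<in>S. norm (A *v x - b) \<le> 1}"

lemma enclosing_eq_INT: "enclosing S = (\<Inter>x\<in>S. (\<lambda>p. fst p *v x - snd p) -` cball 0 1)"
  by (auto simp: enclosing_def)

lemma linear_fst_mult_diff_snd: "linear (\<lambda>p :: (real^'d^'d) \<times> (real^'d). fst p *v x - snd p)"
  by (rule linearI) (simp_all add: matrix_vector_mult_add_rdistrib scaleR_matrix_vector_assoc algebra_simps)

lemma closed_enclosing: "closed (enclosing S)"
  unfolding enclosing_eq_INT
  by (intro closed_INT ballI closed_vimage closed_cball linear_continuous_on
      linear_linear[THEN iffD2] linear_fst_mult_diff_snd)

lemma convex_enclosing: "convex (enclosing S)"
  unfolding enclosing_eq_INT
  by (intro convex_INT convex_linear_vimage convex_cball linear_fst_mult_diff_snd)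

lemma zero_in_enclosing: "0 \<in> enclosing S"
  by (simp add: enclosing_def zero_prod_def)

lemma measure_cball_pos: "0 < measure lebesgue (cball 0 1 :: (real^'d) set)"
  by (simp add: content_cball_pos)

lemma closed_admissible: "closed (admissible :: ((real^'d::{finite,wellorder}^'d::_) \<times> (real^'d::_)) set)"
proof -
  have eq: "(admissible :: ((real^'d::_^'d::_) \<times> (real^'d::_)) set) = (\<Inter>i j. {p. j < i \<longrightarrow> fst p $ i $ j = 0}) \<inter>
      (\<Inter>i. {p. 0 \<le> fst p $ i $ i}) \<inter>
      {p. measure lebesgue (cball 0 1 :: (real^'d::_) set) \<le> (\<Prod>i\<in>UNIV. fst p $ i $ i)}"
    by (auto simp: admissible_def)
  show ?thesis
    unfolding eq
    by (intro closed_Int closed_INT ballI closed_Collect_imp open_Collect_const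
        closed_Collect_le closed_Collect_eq continuous_intros)
qed

lemma convex_admissible: "convex (admissible :: ((real^'d::{finite,wellorder}^'d::_) \<times> (real^'d::_)) set)"
proof -
  let ?c = "measure lebesgue (cball 0 1 :: (real^'d::_) set)"
  have eq: "admissible = ({A :: real^'d::_^'d::_. \<forall>i j. j < i \<longrightarrow> A $ i $ j = 0} \<inter>
      {A. (\<forall>i. 0 \<le> A $ i $ i) \<and> ?c \<le> (\<Prod>i\<in>UNIV. A $ i $ i)}) \<times> (UNIV :: (real^'d::_) set)"
    by (auto simp: admissible_def)
  have "convex {A :: real^'d::_^'d::_. \<forall>i j. j < i \<longrightarrow> A $ i $ j = 0}"
    by (intro subspace_imp_convex) (auto simp: subspace_def)
  then show ?thesis
    unfolding eq by (intro convex_Times convex_Int convex_UNIV convex_prod_diagonal_ge measure_cball_pos)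
qed

lemma zero_notin_admissible: "0 \<notin> (admissible :: ((real^'d::{finite,wellorder}^'d::_) \<times> (real^'d::_)) set)"
  using measure_cball_pos[where 'd='d] by (auto simp: admissible_def zero_prod_def not_le power_0_left)

text \<open>Settles the case of an empty family, where no enclosing condition is imposed.\<close>

lemma admissible_nonempty: "admissible \<noteq> ({} :: ((real^'d::{finite,wellorder}^'d::_) \<times> (real^'d::_)) set)"
proof -
  define m where "m = max 1 (measure lebesgue (cball 0 1 :: (real^'d::_) set))"
  have "m \<le> m ^ CARD('d)"
    using self_le_power[of m "CARD('d)"] by (simp add: m_def)
  then have "(mat m, 0) \<in> (admissible :: ((real^'d::_^'d::_) \<times> (real^'d::_)) set)"
    by (auto simp: admissible_def mat_def m_def)
  then show ?thesis by blast
qed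

section \<open>Ellipsoid volumes and the passage between ellipsoids and pairs\<close>

lemma measure_affine_image_cball:
  fixes f :: "real^'d::{finite,wellorder} \<Rightarrow> real^'d::_"
  assumes "linear f"
  shows "measure lebesgue ((\<lambda>x. f x + b) ` cball 0 1) =
    \<bar>det (matrix f)\<bar> * measure lebesgue (cball 0 1 :: (real^'d::_) set)"
proof -
  have "(\<lambda>x. f x + b) ` cball 0 1 = (+) b ` f ` cball 0 1"
    by (auto simp: image_iff add.commute)
  then show ?thesis
    using assms by (simp add: measure_translation measure_linear_image)
qed

text \<open>From left to right, an ellipsoid is described by its inverse linear map, made triangular
  by a rotation. Conversely, an admissible pair describes a set of volume at most one, which can be
  enlarged to volume exactly one.\<close>

lemma subset_unit_volume_ellipsoid_iff:
  fixes S :: "(real^'d::{finite,wellorder}) set"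
  shows "(\<exists>E. ellipsoid E \<and> measure lebesgue E = 1 \<and> S \<subseteq> E) \<longleftrightarrow> admissible \<inter> enclosing S \<noteq> {}"
    (is "?L \<longleftrightarrow> ?R")
proof
  let ?c = "measure lebesgue (cball 0 1 :: (real^'d::_) set)"
  assume ?L
  then obtain f :: "real^'d::_ \<Rightarrow> real^'d::_" and c where f: "linear f" "bij f"
    and vol: "measure lebesgue ((\<lambda>x. f x + c) ` cball 0 1) = 1" and S: "S \<subseteq> (\<lambda>x. f x + c) ` cball 0 1"
    unfolding ellipsoid_def by blast
  define M where "M = matrix f"
  have fM: "f = (*v) M"
    using matrix_works[of f] f(1) by (auto simp: M_def linear_matrix_vector_mul_eq)
  have "invertible M"
    using f(2) by (simp add: invertible_eq_bij fM)
  \<comment> \<open>The ellipsoid consists of all \<open>x\<close> with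
    \<open>norm (N *v (x - c)) \<le> 1\<close>, and applying an orthogonal \<open>Q\<close> inside
    the norm changes nothing.\<close>
  then obtain N where N: "N ** M = mat 1" "M ** N = mat 1"
    by (auto simp: invertible_def)
  have "invertible N" using N by (auto simp: invertible_def)
  then obtain Q where Q: "orthogonal_matrix Q" and tri: "\<And>i j. j < i \<Longrightarrow> (Q ** N) $ i $ j = 0"
    and diag: "\<And>i. 0 \<le> (Q ** N) $ i $ i"
    using orthogonal_upper_triangularization by blast
  have "(\<Prod>i\<in>UNIV. (Q ** N) $ i $ i) = det (Q ** N)"
    using tri by (simp add: det_upperdiagonal)
  moreover have "0 \<le> (\<Prod>i\<in>UNIV. (Q ** N) $ i $ i)"
    using diag by (simp add: prod_nonneg)
  ultimately have "(\<Prod>i\<in>UNIV. (Q ** N) $ i $ i) = \<bar>det Q\<bar> * \<bar>det N\<bar>"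
    by (metis abs_mult abs_of_nonneg det_mul)
  also have "\<dots> = \<bar>det N\<bar>"
    using det_orthogonal_matrix[OF Q] by auto
  also have "\<dots> = ?c"
  proof -
    have "\<bar>det M\<bar> * ?c = 1"
      using vol by (simp add: measure_affine_image_cball f M_def)
    moreover have "\<bar>det N\<bar> * \<bar>det M\<bar> = 1"
      using arg_cong[OF N(1), of det] by (simp add: det_mul flip: abs_mult)
    ultimately show ?thesis
      by (metis mult.assoc mult.right_neutral mult.left_neutral)
  qed
  finally have "(Q ** N, (Q ** N) *v c) \<in> admissible"
    using tri diag by (simp add: admissible_def)
  moreover have "norm ((Q ** N) *v x - (Q ** N) *v c) \<le> 1" if x: "x \<in> S" for x
  proof -
    obtain y where y: "x = f y + c" "norm y \<le> 1" using S x by auto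
    have "(Q ** N) *v x - (Q ** N) *v c = Q *v ((N ** M) *v y)"
      by (simp add: y fM matrix_vector_right_distrib matrix_vector_mul_assoc matrix_mul_assoc)
    also have "norm \<dots> = norm y"
      using Q N by (simp add: orthogonal_transformation_norm orthogonal_transformation_matrix)
    finally show ?thesis using y by simp
  qed
  then have "(Q ** N, (Q ** N) *v c) \<in> enclosing S"
    by (simp add: enclosing_def)
  ultimately show ?R by blast
next
  let ?c = "measure lebesgue (cball 0 1 :: (real^'d::_) set)"
  assume ?R
  then obtain A b where tri: "\<And>i j. j < i \<Longrightarrow> A $ i $ j = 0" and vol: "?c \<le> (\<Prod>i\<in>UNIV. A $ i $ i)"
    and S: "\<And>x. x \<in> S \<Longrightarrow> norm (A *v x - b) \<le> 1"
    by (auto simp: admissible_def enclosing_def)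
  define p where "p = (\<Prod>i\<in>UNIV. A $ i $ i)"
  \<comment> \<open>The factor that lowers the determinant \<open>p\<close> to \<open>?c\<close>; as
    \<open>t \<le> 1\<close>, the inequality for \<open>(A, b)\<close> survives scaling by
    \<open>t\<close>.\<close>
  define t where "t = root CARD('d) (?c / p)"
  have p: "0 < p" "?c \<le> p"
    using vol less_le_trans[OF measure_cball_pos vol] by (simp_all only: p_def)
  have td: "t ^ CARD('d) = ?c / p"
    using p by (simp add: t_def)
  have t: "0 \<le> t" "t \<le> 1"
    using p by (auto simp: t_def real_root_le_1_iff)
  have "det (t *\<^sub>R A) = t ^ CARD('d) * p"
    using tri by (subst det_upperdiagonal) (auto simp: p_def prod.distrib)
  then have det: "det (t *\<^sub>R A) = ?c"
    using p by (simp add: td)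
  then have "invertible (t *\<^sub>R A)"
    using measure_cball_pos[where 'd='d] by (simp add: invertible_det_nz)
  then obtain B where B: "B ** (t *\<^sub>R A) = mat 1" "(t *\<^sub>R A) ** B = mat 1"
    by (auto simp: invertible_def)
  \<comment> \<open>The solution set of
    \<open>norm ((t *\<^sub>R A) *v x - t *\<^sub>R b) \<le> 1\<close>, written as an affine image
    of the ball.\<close>
  define E where "E = (\<lambda>x. B *v x + B *v (t *\<^sub>R b)) ` cball 0 1"
  have "bij ((*v) B)"
    using B by (auto simp: invertible_def simp flip: invertible_eq_bij)
  then have "ellipsoid E"
    unfolding ellipsoid_def E_def using matrix_vector_mul_linear by blast
  moreover have "measure lebesgue E = 1"
  proof -
    have "\<bar>det B\<bar> * \<bar>det (t *\<^sub>R A)\<bar> = 1"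
      using arg_cong[OF B(1), of det] by (simp add: det_mul flip: abs_mult)
    then show ?thesis
      unfolding E_def by (simp add: measure_affine_image_cball det)
  qed
  moreover have "x \<in> E" if "x \<in> S" for x
  proof -
    define y where "y = (t *\<^sub>R A) *v x - t *\<^sub>R b"
    have "y = t *\<^sub>R (A *v x - b)"
      by (simp add: y_def scaleR_matrix_vector_assoc algebra_simps)
    then have "norm y \<le> 1"
      using t S[OF that] by (simp add: mult_le_one)
    moreover have "B *v y + B *v (t *\<^sub>R b) = (B ** (t *\<^sub>R A)) *v x"
      by (simp add: y_def matrix_vector_mult_diff_distrib matrix_vector_mul_assoc)
    ultimately show ?thesis
      unfolding E_def by (intro image_eqI[of _ _ y]) (auto simp: B)
  qed
  ultimately show ?L by blast
qed

text \<open>The colours match the dimension of the space of pairs: \<open>d (d + 1) / 2\<close> for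
  the triangular matrix plus \<open>d\<close> for the vector. The order on the index type gives
  triangularity its meaning.\<close>

lemma colourful_unit_volume_ellipsoid:
  fixes F :: "nat \<Rightarrow> (real ^ 'd::{finite,wellorder}) set set"
  assumes n: "n = CARD('d) * (CARD('d) + 3) div 2"
    and fin: "\<And>i. i \<in> {1..n} \<Longrightarrow> finite (F i)"
    and sel: "\<And>G. (\<And>i. i \<in> {1..n} \<Longrightarrow> G i \<in> F i) \<Longrightarrow>
           \<exists>E. ellipsoid E \<and> measure lebesgue E = 1 \<and> (\<Union>i\<in>{1..n}. G i) \<subseteq> E"
  shows "\<exists>i\<in>{1..n}. \<exists>E. ellipsoid E \<and> measure lebesgue E = 1 \<and> \<Union>(F i) \<subseteq> E"
proof -
  define U where "U = {A :: real^'d::_^'d::_. \<forall>i j. j < i \<longrightarrow> A $ i $ j = 0}"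
  have U: "subspace U" by (auto simp: U_def subspace_def)
  have "2 * dim (U \<times> (UNIV :: (real^'d::_) set)) = CARD('d) * (CARD('d) + 3)"
    using dim_upper_triangular[where 'd='d]
    by (simp add: dim_Times U subspace_UNIV flip: U_def) (simp add: algebra_simps)
  then have dim: "dim (U \<times> (UNIV :: (real^'d::_) set)) = n"
    unfolding n by linarith
  have "1 * (1 + 3) \<le> CARD('d) * (CARD('d) + 3)"
    by (intro mult_mono) auto
  then have "{1..n} \<noteq> {}" unfolding n by auto
  have enc: "enclosing (\<Union>i\<in>J. G i) = (\<Inter>i\<in>J. enclosing (G i))" for J :: "'j set" and G :: "'j \<Rightarrow> (real^'d::_) set"
    by (auto simp: enclosing_def)
  have "\<exists>i\<in>{1..n}. admissible \<inter> (\<Inter>S\<in>F i. enclosing S) \<noteq> {}"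
  proof (cases "\<exists>i\<in>{1..n}. F i = {}")
    case True
    then show ?thesis using admissible_nonempty by force
  next
    case False
    show ?thesis
    proof (rule colourful_Helly_relative)
      show "subspace (U \<times> (UNIV :: (real^'d::_) set))" "dim (U \<times> (UNIV :: (real^'d::_) set)) \<le> card {1..n}"
        using U dim by (auto simp: subspace_Times)
      show "admissible \<subseteq> U \<times> (UNIV :: (real^'d::_) set)"
        by (auto simp: admissible_def U_def)
      show "admissible \<inter> (\<Inter>i\<in>{1..n}. enclosing (g i)) \<noteq> {}"
        if "\<And>i. i \<in> {1..n} \<Longrightarrow> g i \<in> F i" for g
        using sel[OF that] unfolding subset_unit_volume_ellipsoid_iff enc by blast
    qed (use False fin \<open>{1..n} \<noteq> {}\<close> closed_admissible convex_admissible zero_notin_admissible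
        closed_enclosing convex_enclosing zero_in_enclosing in auto)
  qed
  then show ?thesis
    using enc[of "\<lambda>S. S"] by (simp only: subset_unit_volume_ellipsoid_iff image_ident)
qed

section \<open>Reindexing coordinates\<close>

text \<open>Contravariant in \<open>r\<close>. For bijective \<open>r\<close> this is a linear
  isometry that moves sets between spaces with different index types.\<close>

definition reindex :: "('b \<Rightarrow> 'a) \<Rightarrow> real^'a \<Rightarrow> real^'b" where
  "reindex r x = (\<chi> i. x $ r i)"

lemma linear_reindex: "linear (reindex r)"
  by (rule linearI) (simp_all add: reindex_def vec_eq_iff)

lemma reindex_reindex: "reindex r (reindex s x) = reindex (s \<circ> r) x"
  by (simp add: reindex_def)

lemma reindex_id: "reindex id = id"
  by (simp add: reindex_def fun_eq_iff)

lemma norm_reindex: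
  assumes "bij r"
  shows "norm (reindex r x) = norm x"
proof -
  have "(\<Sum>i\<in>UNIV. (norm (x $ r i))\<^sup>2) = (\<Sum>j\<in>UNIV. (norm (x $ j))\<^sup>2)"
    using assms by (rule sum.reindex_bij_betw)
  then show ?thesis
    by (simp add: norm_vec_def L2_set_def reindex_def)
qed

lemma reindex_inv:
  assumes "bij r"
  shows "reindex r (reindex (inv r) x) = x" "reindex (inv r) (reindex r y) = y"
proof -
  have "inv r \<circ> r = id" "r \<circ> inv r = id"
    using assms by (auto simp: bij_def surj_iff inj_iff)
  then show "reindex r (reindex (inv r) x) = x" "reindex (inv r) (reindex r y) = y"
    by (simp_all add: reindex_reindex reindex_id)
qed

lemma bij_reindex:
  assumes "bij r"
  shows "bij (reindex r)"
  by (rule o_bij[of "reindex (inv r)"]) (auto simp: reindex_inv[OF assms])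

lemma prod_Basis_vec: "(\<Prod>b\<in>(Basis :: (real^'n) set). f b) = (\<Prod>i\<in>UNIV. f (axis i 1))"
proof -
  have eq: "(Basis :: (real^'n) set) = (\<lambda>i. axis i 1) ` UNIV"
    by (auto simp: Basis_vec_def)
  have inj: "inj (\<lambda>i. axis i 1 :: real^'n)"
    by (auto simp: inj_def axis_eq_axis)
  show ?thesis unfolding eq prod.reindex[OF inj] by simp
qed

text \<open>Relabelling coordinates only permutes the sides of a box, and the volumes of boxes
  determine Lebesgue measure.\<close>

lemma lborel_reindex:
  fixes r :: "'b::finite \<Rightarrow> 'a::finite"
  assumes "bij r"
  shows "lborel = distr lborel borel (reindex r)"
proof (rule lborel_eqI)
  have meas: "reindex r \<in> borel_measurable borel"
    by (intro borel_measurable_continuous_onI linear_continuous_on linear_linear[THEN iffD2] linear_reindex)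
  fix l u :: "real^'b"
  assume le: "\<And>b. b \<in> Basis \<Longrightarrow> l \<bullet> b \<le> u \<bullet> b"
  have lu: "l $ i \<le> u $ i" for i
    using le[of "axis i 1"] by (simp add: inner_axis axis_in_Basis_iff)
  have "reindex r -` box l u = box (reindex (inv r) l) (reindex (inv r) u)"
    using assms by (auto simp: mem_box_cart reindex_def bij_is_inj bij_is_surj surj_f_inv_f)
       (metis bij_inv_eq_iff)+
  then have "emeasure (distr lborel borel (reindex r)) (box l u)
      = emeasure lborel (box (reindex (inv r) l) (reindex (inv r) u))"
    using meas by (simp add: emeasure_distr)
  also have "\<dots> = (\<Prod>j\<in>UNIV. (u - l) $ inv r j)"
  proof (subst emeasure_lborel_box)
    show "reindex (inv r) l \<bullet> b \<le> reindex (inv r) u \<bullet> b" if "b \<in> Basis" for b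
      using lu that by (auto simp: Basis_vec_def inner_axis reindex_def)
  qed (simp add: prod_Basis_vec inner_axis reindex_def)
  also have "(\<Prod>j\<in>UNIV. (u - l) $ inv r j) = (\<Prod>i\<in>UNIV. (u - l) $ i)"
    using bij_imp_bij_inv[OF assms] by (rule prod.reindex_bij_betw)
  finally show "emeasure (distr lborel borel (reindex r)) (box l u) = (\<Prod>b\<in>Basis. (u - l) \<bullet> b)"
    by (simp add: prod_Basis_vec inner_axis)
qed simp

lemma measure_reindex_image:
  fixes r :: "'b::finite \<Rightarrow> 'a::finite"
  assumes r: "bij r" and S: "S \<in> sets borel"
  shows "measure lebesgue (reindex r ` S) = measure lebesgue S"
proof -
  let ?s = "reindex (inv r)"
  have s: "bij (inv r)" using r by (rule bij_imp_bij_inv)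
  have meas: "?s \<in> borel_measurable borel"
    by (intro borel_measurable_continuous_onI linear_continuous_on linear_linear[THEN iffD2] linear_reindex)
  \<comment> \<open>As a preimage under the inverse map, the image is measured by the pushforward of
    \<open>lborel\<close>.\<close>
  have eq: "reindex r ` S = ?s -` S"
    using reindex_inv[OF r] by (auto simp: image_iff) metis
  have "?s -` S \<in> sets borel"
    using measurable_sets[OF meas S] by simp
  then have "measure lebesgue (reindex r ` S) = measure lborel (?s -` S)"
    by (simp add: eq measure_completion)
  also have "\<dots> = measure (distr lborel borel ?s) S"
    using meas S by (simp add: measure_distr)
  also have "\<dots> = measure lebesgue S"
    using S by (simp flip: lborel_reindex[OF s] add: measure_completion)
  finally show ?thesis .
qed

lemma ellipsoid_reindex:
  fixes r :: "'b::finite \<Rightarrow> 'a::finite"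
  assumes r: "bij r" and E: "ellipsoid E"
  shows "ellipsoid (reindex r ` E)"
proof -
  obtain f :: "real^'a \<Rightarrow> real^'a" and b where f: "linear f" "bij f"
    and E: "E = (\<lambda>x. f x + b) ` cball 0 1"
    using E unfolding ellipsoid_def by blast
  \<comment> \<open>The linear part is conjugated by the relabelling, which preserves the unit
    ball.\<close>
  define g where "g = reindex r \<circ> f \<circ> reindex (inv r)"
  have "linear g" "bij g"
    unfolding g_def using f r bij_imp_bij_inv[OF r]
    by (auto intro!: linear_compose linear_reindex bij_comp bij_reindex)
  moreover have ball: "cball 0 1 = reindex r ` cball 0 1"
  proof
    show "cball 0 1 \<subseteq> reindex r ` cball 0 1"
    proof
      fix y :: "real^'b" assume "y \<in> cball 0 1"
      then show "y \<in> reindex r ` cball 0 1"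
        using norm_reindex[OF bij_imp_bij_inv[OF r], of y]
        by (intro image_eqI[of _ _ "reindex (inv r) y"]) (auto simp: reindex_inv[OF r])
    qed
  qed (auto simp: norm_reindex[OF r])
  have "reindex r ` E = (\<lambda>x. g x + reindex r b) ` cball 0 1"
    by (subst ball) (simp add: E g_def image_image reindex_inv[OF r] linear_add[OF linear_reindex])
  ultimately show ?thesis unfolding ellipsoid_def by blast
qed

lemma ellipsoid_borel:
  assumes "ellipsoid E"
  shows "E \<in> sets borel"
proof -
  obtain f :: "real^'a \<Rightarrow> real^'a" and b where f: "linear f" and E: "E = (\<lambda>x. f x + b) ` cball 0 1"
    using assms unfolding ellipsoid_def by blast
  have "compact E"
    unfolding E using f by (intro compact_continuous_image continuous_intros linear_continuous_on compact_cball)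
      (simp add: linear_linear)
  then show ?thesis by (simp add: borel_compact)
qed

text \<open>
  The library proves the volume formula for linear images only for well-ordered index types;
  this copy of a finite type supplies such an index type.
\<close>

typedef 'a ordered_copy = "UNIV :: 'a set" by simp

instance ordered_copy :: (finite) finite
proof
  have "surj (Abs_ordered_copy :: 'a \<Rightarrow> 'a ordered_copy)"
    by (metis surjI Rep_ordered_copy_inverse)
  then show "finite (UNIV :: 'a ordered_copy set)"
    by (metis finite_code finite_imageI)
qed

instantiation ordered_copy :: (finite) linorder
begin

definition less_eq_ordered_copy :: "'a ordered_copy \<Rightarrow> 'a ordered_copy \<Rightarrow> bool" where
  "less_eq_ordered_copy x y \<longleftrightarrow> to_nat (Rep_ordered_copy x) \<le> to_nat (Rep_ordered_copy y)"

definition less_ordered_copy :: "'a ordered_copy \<Rightarrow> 'a ordered_copy \<Rightarrow> bool" where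
  "less_ordered_copy x y \<longleftrightarrow> to_nat (Rep_ordered_copy x) < to_nat (Rep_ordered_copy y)"

instance
  by standard (auto simp: less_eq_ordered_copy_def less_ordered_copy_def Rep_ordered_copy_inject
      dest!: antisym)

end

instance ordered_copy :: (finite) wellorder
proof -
  have "wf {(x :: 'a ordered_copy, y). x < y}"
    by (rule wf_subset[OF wf_measure[of "\<lambda>x. to_nat (Rep_ordered_copy x)"]])
      (auto simp: less_ordered_copy_def)
  then show "OFCLASS('a ordered_copy, wellorder_class)"
    by (rule wf_wellorderI) intro_classes
qed

text \<open>Relabelling carries the families to the ordered copy and the resulting ellipsoid back;
  it preserves inclusions, ellipsoids and volumes.\<close>

theorem theorem3p13:
  fixes F :: "nat \<Rightarrow> (real ^ 'd::finite) set set" and n :: nat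
  assumes "n = CARD('d) * (CARD('d) + 3) div 2"
    and "\<And>i. i \<in> {1..n} \<Longrightarrow> finite (F i)"
    and "\<And>i S. i \<in> {1..n} \<Longrightarrow> S \<in> F i \<Longrightarrow> bounded S"
    and "\<And>G. (\<And>i. i \<in> {1..n} \<Longrightarrow> G i \<in> F i) \<Longrightarrow>
           \<exists>E. ellipsoid E \<and> measure lebesgue E = 1 \<and> (\<Union>i\<in>{1..n}. G i) \<subseteq> E"
  shows "\<exists>i\<in>{1..n}. \<exists>E. ellipsoid E \<and> measure lebesgue E = 1 \<and> \<Union>(F i) \<subseteq> E"
proof -
  define r where "r = (Rep_ordered_copy :: 'd ordered_copy \<Rightarrow> 'd)"
  have r: "bij r"
    unfolding r_def by (metis bijI' Rep_ordered_copy_inject Abs_ordered_copy_inverse UNIV_I)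
  have s: "bij (inv r)" using r by (rule bij_imp_bij_inv)
  have card: "CARD('d ordered_copy) = CARD('d)"
    using r by (rule bij_betw_same_card)
  let ?\<phi> = "reindex r" and ?\<psi> = "reindex (inv r)"
  have \<psi>\<phi>: "?\<psi> ` ?\<phi> ` S = S" for S
    by (simp add: image_image reindex_inv[OF r])
  define F' where "F' i = (`) ?\<phi> ` F i" for i
  have "\<exists>i\<in>{1..n}. \<exists>E. ellipsoid E \<and> measure lebesgue E = 1 \<and> \<Union>(F' i) \<subseteq> E"
  proof (rule colourful_unit_volume_ellipsoid)
    show "n = CARD('d ordered_copy) * (CARD('d ordered_copy) + 3) div 2"
      using assms(1) by (simp add: card)
    show "finite (F' i)" if "i \<in> {1..n}" for i
      using assms(2)[OF that] by (simp add: F'_def)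
    fix G assume G: "\<And>i. i \<in> {1..n} \<Longrightarrow> G i \<in> F' i"
    have "?\<psi> ` G i \<in> F i" if "i \<in> {1..n}" for i
      using G[OF that] by (auto simp: F'_def \<psi>\<phi>)
    from assms(4)[of "\<lambda>i. ?\<psi> ` G i", OF this] obtain E where E: "ellipsoid E" "measure lebesgue E = 1"
      and sub: "(\<Union>i\<in>{1..n}. ?\<psi> ` G i) \<subseteq> E" by blast
    have "x \<in> ?\<phi> ` E" if "i \<in> {1..n}" "x \<in> G i" for x i
    proof
      show "x = ?\<phi> (?\<psi> x)" by (simp add: reindex_inv[OF r])
      show "?\<psi> x \<in> E" using sub that by blast
    qed
    then have "(\<Union>i\<in>{1..n}. G i) \<subseteq> ?\<phi> ` E" by blast
    then show "\<exists>E. ellipsoid E \<and> measure lebesgue E = 1 \<and> (\<Union>i\<in>{1..n}. G i) \<subseteq> E"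
      using ellipsoid_reindex[OF r E(1)] measure_reindex_image[OF r ellipsoid_borel[OF E(1)]] E(2)
      by metis
  qed
  then obtain i E where i: "i \<in> {1..n}" and E: "ellipsoid E" "measure lebesgue E = 1"
    and sub: "\<Union>(F' i) \<subseteq> E" by blast
  have "\<Union>(F i) \<subseteq> ?\<psi> ` E"
  proof
    fix x assume "x \<in> \<Union>(F i)"
    then have "?\<phi> x \<in> E" using sub by (auto simp: F'_def)
    then show "x \<in> ?\<psi> ` E" by (intro image_eqI[of _ _ "?\<phi> x"]) (auto simp: reindex_inv[OF r])
  qed
  then show ?thesis
    using i ellipsoid_reindex[OF s E(1)] measure_reindex_image[OF s ellipsoid_borel[OF E(1)]] E(2)
    by metis
qed

end
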